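(* There exist integral domains that are neither antimatter nor quasi-Furstenberg.
   Context: An antimatter domain is an integral domain that contains no irreducible elements. An integral domain $D$ is quasi-Furstenberg if for every nonzero non-unit $\alpha\in D$ there exist $\beta,\pi\in D$ such that $\pi$ is irreducible, $\pi$ divides $\alpha\beta$, and $\pi$ does not divide $\beta$. *)

theory Defs
  imports "HOL-Algebra.Ring_Divisibility"
begin

text \<open>
  Irreducibles are expressed with \<^term>\<open>ring_irreducible\<^bsub>R\<^esub> r\<close>, which also excludes
  \<open>r = \<zero>\<close>; the purely multiplicative \<^term>\<open>irreducible R r\<close> would count \<open>\<zero>\<close>
  as irreducible when \<open>R\<close> is a field.
\<close>

definition antimatter_domain :: "('a, 'b) ring_scheme \<Rightarrow> bool"
  where "antimatter_domain R \<longleftrightarrow>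
    domain R \<and> \<not> (\<exists>r \<in> carrier R. ring_irreducible\<^bsub>R\<^esub> r)"

definition quasi_Furstenberg :: "('a, 'b) ring_scheme \<Rightarrow> bool"
  where "quasi_Furstenberg R \<longleftrightarrow>
    domain R \<and>
    (\<forall>\<alpha> \<in> carrier R. \<alpha> \<noteq> \<zero>\<^bsub>R\<^esub> \<and> \<alpha> \<notin> Units R \<longrightarrow>
      (\<exists>\<beta> \<in> carrier R. \<exists>\<pi> \<in> carrier R. ring_irreducible\<^bsub>R\<^esub> \<pi> \<and>
        \<pi> divides\<^bsub>R\<^esub> (\<alpha> \<otimes>\<^bsub>R\<^esub> \<beta>) \<and> \<not> \<pi> divides\<^bsub>R\<^esub> \<beta>))"

end

theory Submission
  imports Defs "HOL-Algebra.Weak_Morphisms" "HOL-Library.Countable_Set"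
    "HOL-Library.Poly_Mapping"
begin

text \<open>
  Let \<open>R = \<int>[x; \<rat>\<^sub>\<ge>\<^sub>0]\<close> be the ring of integer polynomials with nonnegative rational exponents.
  The constant \<open>2\<close> is irreducible, by degree considerations. For \<open>\<alpha> = x\<close> the quasi-Furstenberg
  condition fails: an irreducible \<open>\<pi>\<close> has nonzero constant coefficient, since otherwise some
  \<open>x\<^sup>q\<close> with \<open>q > 0\<close> divides it, and \<open>x\<^sup>q\<close> is the square of \<open>x\<close> to the power \<open>q/2\<close>. Hence if
  \<open>\<pi> \<gamma> = x \<beta>\<close>, the lowest exponent of \<open>\<gamma>\<close> is at least \<open>1\<close>, so that \<open>\<gamma>\<close> is divisible by \<open>x\<close>
  and \<open>\<pi>\<close> divides \<open>\<beta>\<close>. Finally, \<open>R\<close> is countable, hence isomorphic to a ring on \<open>\<nat>\<close>.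
\<close>

section \<open>Invariance under ring isomorphisms\<close>

context
  fixes R :: "('a, 'c) ring_scheme" and S :: "('b, 'd) ring_scheme" and h
  assumes iso: "h \<in> ring_iso R S"
begin

lemma ring_iso_carrier_eq: "carrier S = h ` carrier R"
  using ring_iso_memE(5)[OF iso] by (simp add: bij_betw_def)

lemma ring_iso_eq_iff: "a \<in> carrier R \<Longrightarrow> b \<in> carrier R \<Longrightarrow> h a = h b \<longleftrightarrow> a = b"
  using ring_iso_memE(5)[OF iso] by (auto simp: bij_betw_def dest: inj_onD)

lemma ring_iso_divides_iff:
  assumes "monoid R" "a \<in> carrier R" "b \<in> carrier R"
  shows "h a divides\<^bsub>S\<^esub> h b \<longleftrightarrow> a divides\<^bsub>R\<^esub> b"
  unfolding factor_def ring_iso_carrier_eq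
  using assms ring_iso_eq_iff ring_iso_memE(2)[OF iso]
  by (simp flip: ring_iso_memE(2)[OF iso] add: monoid.m_closed)

lemma ring_iso_Units_iff:
  assumes "monoid R" "a \<in> carrier R"
  shows "h a \<in> Units S \<longleftrightarrow> a \<in> Units R"
  unfolding Units_def ring_iso_carrier_eq
  using assms ring_iso_eq_iff
  by (auto simp flip: ring_iso_memE(2)[OF iso] ring_iso_memE(4)[OF iso]
      simp add: monoid.m_closed monoid.one_closed)

lemma ring_iso_ring_irreducible_iff:
  assumes "ring R" "ring S" "a \<in> carrier R"
  shows "ring_irreducible\<^bsub>S\<^esub> (h a) \<longleftrightarrow> ring_irreducible\<^bsub>R\<^esub> a"
proof -
  interpret R: ring R by fact
  have "h \<zero>\<^bsub>R\<^esub> = \<zero>\<^bsub>S\<^esub>"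
    using iso assms by (auto simp: ring_iso_def intro: ring_hom_zero)
  then have "h a = \<zero>\<^bsub>S\<^esub> \<longleftrightarrow> a = \<zero>\<^bsub>R\<^esub>"
    using ring_iso_eq_iff[OF assms(3) R.zero_closed] by simp
  moreover have "irreducible S (h a) \<longleftrightarrow> irreducible R a"
    using assms(3) ring_iso_divides_iff[OF R.monoid_axioms] ring_iso_Units_iff[OF R.monoid_axioms]
    by (simp add: irreducible_def properfactor_def ring_iso_carrier_eq)
  ultimately show ?thesis
    by (simp add: ring_irreducible_def)
qed

text \<open>Runs from the codomain back to the domain, so that by contraposition a ring failing the
  property passes the failure on to every isomorphic copy. The same holds for
  \<open>ring_iso_quasi_Furstenberg\<close>.\<close>

lemma ring_iso_antimatter_domain:
  assumes "domain R" "antimatter_domain S"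
  shows "antimatter_domain R"
proof -
  interpret R: domain R by fact
  have "ring S"
    using assms(2) by (simp add: antimatter_domain_def domain_def cring_def)
  then show ?thesis
    using assms ring_iso_ring_irreducible_iff[OF R.ring_axioms]
    by (simp add: antimatter_domain_def ring_iso_carrier_eq)
qed

lemma ring_iso_quasi_Furstenberg:
  assumes "domain R" "quasi_Furstenberg S"
  shows "quasi_Furstenberg R"
proof -
  interpret R: domain R by fact
  have S: "ring S"
    using assms(2) by (simp add: quasi_Furstenberg_def domain_def cring_def)
  have z: "h \<zero>\<^bsub>R\<^esub> = \<zero>\<^bsub>S\<^esub>"
    using iso S R.ring_axioms by (auto simp: ring_iso_def intro: ring_hom_zero)
  show ?thesis
    unfolding quasi_Furstenberg_def
  proof (intro conjI ballI impI)
    fix \<alpha> assume \<alpha>: "\<alpha> \<in> carrier R" "\<alpha> \<noteq> \<zero>\<^bsub>R\<^esub> \<and> \<alpha> \<notin> Units R"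
    have "h \<alpha> \<noteq> \<zero>\<^bsub>S\<^esub>"
      using \<alpha> ring_iso_eq_iff[OF \<alpha>(1) R.zero_closed] by (simp add: z)
    then obtain \<beta> \<pi> where "\<beta> \<in> carrier R" "\<pi> \<in> carrier R" "ring_irreducible\<^bsub>S\<^esub> (h \<pi>)"
      "h \<pi> divides\<^bsub>S\<^esub> (h \<alpha> \<otimes>\<^bsub>S\<^esub> h \<beta>)" "\<not> h \<pi> divides\<^bsub>S\<^esub> h \<beta>"
      using assms(2) \<alpha> ring_iso_Units_iff[OF R.monoid_axioms \<alpha>(1)]
      by (auto simp: quasi_Furstenberg_def ring_iso_carrier_eq)
    then show "\<exists>\<beta>\<in>carrier R. \<exists>\<pi>\<in>carrier R. ring_irreducible\<^bsub>R\<^esub> \<pi> \<and>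
        \<pi> divides\<^bsub>R\<^esub> (\<alpha> \<otimes>\<^bsub>R\<^esub> \<beta>) \<and> \<not> \<pi> divides\<^bsub>R\<^esub> \<beta>"
      using \<alpha>(1) ring_iso_ring_irreducible_iff[OF R.ring_axioms S]
        ring_iso_divides_iff[OF R.monoid_axioms]
      by (auto simp flip: ring_iso_memE(2)[OF iso])
  qed (fact assms(1))
qed

end

text \<open>An injective numbering of the carrier transports the ring structure to its image, a
  possibly proper subset of the natural numbers.\<close>

lemma countable_domain_iso_nat:
  fixes R :: "('a, 'c) ring_scheme"
  assumes "domain R" "countable (carrier R)"
  obtains S :: "nat ring" and h where "domain S" "h \<in> ring_iso R S"
proof -
  interpret R: domain R by fact
  let ?h = "to_nat_on (carrier R)"
  have inj: "inj_on ?h (carrier R)"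
    using assms(2) by (rule inj_on_to_nat_on)
  have "?h \<in> ring_iso R (image_ring ?h R)"
    using inj_imp_image_ring_iso[OF inj] .
  moreover have "domain (image_ring ?h R)"
    using R.inj_imp_image_ring_is_domain[OF inj] .
  ultimately show thesis
    using that by blast
qed

section \<open>Finitely supported functions\<close>

abbreviation "lookup \<equiv> Poly_Mapping.lookup"
abbreviation "keys \<equiv> Poly_Mapping.keys"

text \<open>Only one summand of the convolution survives when no other pair of exponents has the
  same sum. This is applied to constant, highest and lowest coefficients.\<close>

lemma lookup_mult_unique:
  fixes f g :: "'a::monoid_add \<Rightarrow>\<^sub>0 'b::semiring_0"
  assumes "\<And>i j. i \<in> keys f \<Longrightarrow> j \<in> keys g \<Longrightarrow> i + j = a + b \<Longrightarrow> i = a \<and> j = b"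
  shows "lookup (f * g) (a + b) = lookup f a * lookup g b"
proof -
  have "lookup f l * (\<Sum>q. lookup g q when a + b = l + q) = (lookup f a * lookup g b when l = a)" for l
  proof (cases "l \<in> keys f")
    case True
    \<comment> \<open>Both sides vanish in \<open>q\<close> off a single point, so the inner sum
      collapses.\<close>
    then have "(lookup g q when a + b = l + q) = (lookup g b when l = a when q = b)" for q
    proof (cases "q \<in> keys g \<and> a + b = l + q")
      case True
      then have "l = a \<and> q = b"
        using assms[OF \<open>l \<in> keys f\<close>, of q] by metis
      then show ?thesis
        by simp
    next
      case False
      have "(lookup g q when a + b = l + q) = 0"
        using False unfolding in_keys_iff when_def by metis
      moreover have "(lookup g b when l = a when q = b) = 0"
        using False unfolding in_keys_iff when_def by metis
      ultimately show ?thesis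
        by simp
    qed
    then show ?thesis
      by (simp add: when_def)
  qed (auto simp: in_keys_iff when_def)
  then show ?thesis
    by (simp add: lookup_mult)
qed

text \<open>The graph over the support determines the function and is a finite subset of a countable
  type.\<close>

lemma countable_poly_mapping:
  "countable (UNIV :: ('a::countable \<Rightarrow>\<^sub>0 'b::{countable, zero}) set)"
proof -
  let ?graph = "\<lambda>f :: 'a \<Rightarrow>\<^sub>0 'b. (\<lambda>k. (k, lookup f k)) ` keys f"
  have "inj ?graph"
  proof (rule injI, rule poly_mapping_eqI)
    fix f g k assume eq: "?graph f = ?graph g"
    have *: "(k, v) \<in> ?graph f' \<longleftrightarrow> v \<noteq> 0 \<and> lookup f' k = v" for v f'
      by (auto simp: in_keys_iff)
    show "lookup f k = lookup g k"
      using *[of "lookup f k" f] *[of "lookup g k" g] *[of "lookup f k" g] *[of "lookup g k" f]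
      unfolding eq by metis
  qed
  moreover have "countable (range ?graph)"
    by (rule countable_subset[OF _ countable_Collect_finite]) auto
  ultimately show ?thesis
    by (rule countable_image_inj_on[rotated])
qed

section \<open>Polynomials with nonnegative rational exponents\<close>

text \<open>This is the monoid algebra of the nonnegative rationals over the integers, cut out of
  the group algebra of all rationals so that negative powers of x remain available for
  shifting.\<close>

definition puiseux_ring :: "(rat \<Rightarrow>\<^sub>0 int) ring"
  where "puiseux_ring =
    \<lparr>carrier = {f. \<forall>k \<in> keys f. 0 \<le> k}, monoid.mult = (*), one = 1, zero = 0, add = (+)\<rparr>"

lemma puiseux_ring_simps [simp]:
  "f \<in> carrier puiseux_ring \<longleftrightarrow> (\<forall>k \<in> keys f. 0 \<le> k)"
  "f \<otimes>\<^bsub>puiseux_ring\<^esub> g = f * g"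
  "\<one>\<^bsub>puiseux_ring\<^esub> = 1" "\<zero>\<^bsub>puiseux_ring\<^esub> = 0"
  "f \<oplus>\<^bsub>puiseux_ring\<^esub> g = f + g"
  by (simp_all add: puiseux_ring_def)

lemma mult_in_puiseux_ring:
  assumes "f \<in> carrier puiseux_ring" "g \<in> carrier puiseux_ring"
  shows "f * g \<in> carrier puiseux_ring"
  using assms keys_mult[of f g] by fastforce

lemma domain_puiseux_ring: "domain puiseux_ring"
proof -
  have "cring puiseux_ring"
  proof (intro cringI abelian_groupI comm_monoidI)
    fix f assume "f \<in> carrier puiseux_ring"
    then show "\<exists>g \<in> carrier puiseux_ring. g \<oplus>\<^bsub>puiseux_ring\<^esub> f = \<zero>\<^bsub>puiseux_ring\<^esub>"
      by (intro bexI[of _ "- f"]) auto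
  next
    fix f g assume "f \<in> carrier puiseux_ring" "g \<in> carrier puiseux_ring"
    then show "f \<oplus>\<^bsub>puiseux_ring\<^esub> g \<in> carrier puiseux_ring"
      using keys_add[of f g] by fastforce
  next
    fix f g assume "f \<in> carrier puiseux_ring" "g \<in> carrier puiseux_ring"
    then show "f \<otimes>\<^bsub>puiseux_ring\<^esub> g \<in> carrier puiseux_ring"
      unfolding puiseux_ring_simps(2) by (rule mult_in_puiseux_ring)
  qed (simp_all add: algebra_simps)
  \<comment> \<open>Absence of zero divisors is inherited from the ambient type, whose exponents are
    linearly ordered.\<close>
  then show ?thesis
    by (rule domainI) auto
qed

text \<open>Among nonnegative exponents, 0 splits only as 0 + 0.\<close>

lemma lookup_mult_0:
  assumes "f \<in> carrier puiseux_ring" "g \<in> carrier puiseux_ring"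
  shows "lookup (f * g) 0 = lookup f 0 * lookup g 0"
  using lookup_mult_unique[of f g 0 0] assms by (auto simp: add_nonneg_eq_0_iff)

lemma Units_lookup_0:
  assumes "f \<in> Units puiseux_ring"
  shows "lookup f 0 dvd 1"
proof -
  obtain g where "f \<in> carrier puiseux_ring" "g \<in> carrier puiseux_ring" "f * g = 1"
    using assms by (auto simp: Units_def)
  then have "1 = lookup f 0 * lookup g 0"
    using lookup_mult_0[of f g] by simp
  then show ?thesis
    by (rule dvdI)
qed

lemma keys_shift:
  fixes f :: "rat \<Rightarrow>\<^sub>0 int"
  assumes "k \<in> keys (Poly_Mapping.single c 1 * f)"
  shows "k - c \<in> keys f"
  using keys_mult[of "Poly_Mapping.single c 1" f] assms by auto

lemma single_mult_shift:
  fixes f :: "rat \<Rightarrow>\<^sub>0 int"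
  shows "Poly_Mapping.single c 1 * (Poly_Mapping.single (- c) 1 * f) = f"
  by (simp add: mult_single flip: mult.assoc)

lemma puiseux_irreducible_lookup_0:
  assumes "p \<in> carrier puiseux_ring" "ring_irreducible\<^bsub>puiseux_ring\<^esub> p"
  shows "lookup p 0 \<noteq> 0"
proof
  interpret domain puiseux_ring by (rule domain_puiseux_ring)
  assume p0: "lookup p 0 = 0"
  have "p \<noteq> 0"
    using ring_irreducibleE(1)[OF assms] by simp
  define q where "q = Min (keys p)"
  have q: "q \<in> keys p" "\<And>k. k \<in> keys p \<Longrightarrow> q \<le> k"
    using \<open>p \<noteq> 0\<close> by (simp_all add: q_def)
  have "q \<noteq> 0"
    using q(1) p0 by (auto simp: in_keys_iff)
  then have "0 < q"
    using q(1) assms(1) by force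
  \<comment> \<open>Halving the lowest exponent leaves positive exponents in both factors, so
    neither has a constant term and neither can be a unit.\<close>
  let ?m = "Poly_Mapping.single (q/2) (1::int)" and ?p' = "Poly_Mapping.single (- (q/2)) 1 * p"
  have keys: "q/2 \<le> k" if "k \<in> keys ?p'" for k
    using q(2)[OF keys_shift[OF that]] by simp
  have "?m \<in> carrier puiseux_ring" "?p' \<in> carrier puiseux_ring"
    using keys \<open>0 < q\<close> by force+
  moreover have "p = ?m \<otimes>\<^bsub>puiseux_ring\<^esub> ?p'"
    by (simp add: single_mult_shift)
  ultimately have "?m \<in> Units puiseux_ring \<or> ?p' \<in> Units puiseux_ring"
    by (rule ring_irreducibleE(5)[OF assms])
  moreover have "lookup ?m 0 = 0"
    using \<open>0 < q\<close> by (simp add: lookup_single)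
  moreover have "lookup ?p' 0 = 0"
    using keys[of 0] \<open>0 < q\<close> by (force simp: in_keys_iff)
  ultimately show False
    using Units_lookup_0[of ?m] Units_lookup_0[of ?p'] by (metis not_is_unit_0)
qed

text \<open>Highest exponents add, since the product of the two leading coefficients is nonzero.
  Their sum is 0 and both are nonnegative, so both are 0.\<close>

lemma keys_constant_factor:
  assumes "f \<in> carrier puiseux_ring" "g \<in> carrier puiseux_ring" "keys (f * g) = {0}"
  shows "keys f = {0}"
proof -
  have "f \<noteq> 0" "g \<noteq> 0"
    using assms(3) by auto
  define a where "a = Max (keys f)"
  define b where "b = Max (keys g)"
  have a: "a \<in> keys f" "\<And>k. k \<in> keys f \<Longrightarrow> k \<le> a"
    using \<open>f \<noteq> 0\<close> by (simp_all add: a_def)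
  have b: "b \<in> keys g" "\<And>k. k \<in> keys g \<Longrightarrow> k \<le> b"
    using \<open>g \<noteq> 0\<close> by (simp_all add: b_def)
  have "lookup (f * g) (a + b) = lookup f a * lookup g b"
    by (rule lookup_mult_unique) (use a b in fastforce)
  then have "a + b \<in> keys (f * g)"
    using a(1) b(1) by (simp add: in_keys_iff)
  then have "a = 0"
    using assms a(1) b(1) by force
  then have "keys f \<subseteq> {0}"
    using a(2) assms(1) by fastforce
  then show ?thesis
    using a(1) by auto
qed

text \<open>Both factors of 2 must be constants, which leaves the factorisations of 2 in the
  integers.\<close>

lemma ring_irreducible_two: "ring_irreducible\<^bsub>puiseux_ring\<^esub> 2"
proof -
  interpret domain puiseux_ring by (rule domain_puiseux_ring)
  have two: "2 = Poly_Mapping.single (0::rat) (2::int)"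
    by (simp flip: single_numeral)
  show ?thesis
  proof (rule ring_irreducibleI)
    show "2 \<in> carrier puiseux_ring - {\<zero>\<^bsub>puiseux_ring\<^esub>}"
      by (auto simp: lookup_numeral in_keys_iff when_def split: if_splits)
    show "2 \<notin> Units puiseux_ring"
      using Units_lookup_0[of 2] by (auto simp: two simp del: single_numeral)
  next
    fix f g assume fg: "f \<in> carrier puiseux_ring" "g \<in> carrier puiseux_ring"
      and "2 = f \<otimes>\<^bsub>puiseux_ring\<^esub> g"
    then have eq: "f * g = Poly_Mapping.single 0 2"
      by (simp add: two del: single_numeral)
    then have kfg: "keys (f * g) = {0}"
      by (simp del: single_numeral)
    then have kgf: "keys (g * f) = {0}"
      by (simp only: mult.commute)
    have const: "h = Poly_Mapping.single 0 (lookup h 0)" if "keys h = {0}" for h :: "rat \<Rightarrow>\<^sub>0 int"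
    proof (rule poly_mapping_eqI)
      fix k
      have "lookup h k = 0" if "k \<noteq> 0"
        using that \<open>keys h = {0}\<close> in_keys_iff[of k h] by simp
      then show "lookup h k = lookup (Poly_Mapping.single 0 (lookup h 0)) k"
        by (simp add: lookup_single when_def)
    qed
    note f = const[OF keys_constant_factor[OF fg kfg]]
      and g = const[OF keys_constant_factor[OF fg(2,1) kgf]]
    have unit: "h \<in> Units puiseux_ring"
      if "h = Poly_Mapping.single 0 c" "c dvd 1" "h \<in> carrier puiseux_ring"
      for h :: "rat \<Rightarrow>\<^sub>0 int" and c
    proof -
      \<comment> \<open>An integer unit is 1 or -1, hence its own inverse.\<close>
      have "c * c = 1"
        using that(2) by (metis abs_mult_self_eq mult_1 zdvd1_eq)
      then have "h * h = 1"
        by (simp add: that(1) mult_single)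
      then show ?thesis
        using that(3) by (auto simp: Units_def)
    qed
    have prod: "lookup f 0 * lookup g 0 = 2"
      using lookup_mult_0[OF fg] by (simp add: eq del: single_numeral)
    then have "\<bar>lookup f 0\<bar> \<le> 2"
      using dvd_imp_le_int[of 2 "lookup f 0"] by (metis abs_numeral dvd_triv_left zero_neq_numeral)
    then have "lookup f 0 \<in> {- 2, - 1, 0, 1, 2}"
      by auto
    then have "lookup f 0 dvd 1 \<or> lookup g 0 dvd 1"
      using prod by auto
    then show "f \<in> Units puiseux_ring \<or> g \<in> Units puiseux_ring"
      using unit[OF f _ fg(1)] unit[OF g _ fg(2)] by blast
  qed
qed

lemma not_antimatter_puiseux_ring: "\<not> antimatter_domain puiseux_ring"
proof -
  have "(2::rat \<Rightarrow>\<^sub>0 int) \<in> carrier puiseux_ring"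
    by (simp flip: single_numeral)
  then show ?thesis
    using ring_irreducible_two by (auto simp: antimatter_domain_def)
qed

lemma not_quasi_Furstenberg_puiseux_ring: "\<not> quasi_Furstenberg puiseux_ring"
proof
  let ?x = "Poly_Mapping.single 1 1 :: rat \<Rightarrow>\<^sub>0 int"
  assume "quasi_Furstenberg puiseux_ring"
  moreover have "?x \<in> carrier puiseux_ring" "?x \<noteq> \<zero>\<^bsub>puiseux_ring\<^esub>"
    by simp_all
  moreover have "?x \<notin> Units puiseux_ring"
    using Units_lookup_0[of ?x] by (auto simp: lookup_single)
  ultimately obtain b p where b: "b \<in> carrier puiseux_ring"
    and p: "p \<in> carrier puiseux_ring" "ring_irreducible\<^bsub>puiseux_ring\<^esub> p"
    and dvd: "p divides\<^bsub>puiseux_ring\<^esub> (?x \<otimes>\<^bsub>puiseux_ring\<^esub> b)"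
    and ndvd: "\<not> p divides\<^bsub>puiseux_ring\<^esub> b"
    unfolding quasi_Furstenberg_def by blast
  obtain c where c: "c \<in> carrier puiseux_ring" "?x * b = p * c"
    using dvd by (auto simp: factor_def)
  have ge: "1 \<le> k" if "k \<in> keys c" for k
  proof (rule ccontr)
    assume "\<not> 1 \<le> k"
    define m where "m = Min (keys c)"
    have m: "m \<in> keys c" "\<And>k. k \<in> keys c \<Longrightarrow> m \<le> k"
      unfolding m_def using that by (blast intro: Min_in finite_keys, simp)
    \<comment> \<open>As \<open>p\<close> has no negative exponents and \<open>c\<close> none below
      \<open>m\<close>, the exponent \<open>m\<close> arises only as 0 + \<open>m\<close>. The
      constant term of \<open>p\<close> is nonzero, so \<open>m\<close> survives in the
      product.\<close>
    have "lookup (p * c) (0 + m) = lookup p 0 * lookup c m"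
      by (rule lookup_mult_unique) (use m p(1) in fastforce)
    then have "m \<in> keys (?x * b)"
      using puiseux_irreducible_lookup_0[OF p] m(1) by (simp add: in_keys_iff c(2))
    then have "1 \<le> m"
      using keys_shift[of m 1 b] b by fastforce
    then show False
      using m(2)[OF that] \<open>\<not> 1 \<le> k\<close> by simp
  qed
  \<comment> \<open>The quotient of \<open>c\<close> by x, which has no negative exponents by
    \<open>ge\<close>.\<close>
  define d where "d = Poly_Mapping.single (- 1) 1 * c"
  have "d \<in> carrier puiseux_ring"
    using ge keys_shift[of _ "- 1" c] by (fastforce simp: d_def)
  moreover have "?x * b = ?x * (p * d)"
    using single_mult_shift[of 1 c] by (simp add: c(2) d_def mult.left_commute)
  then have "b = p * d"
    by (metis mult_left_cancel single_zero single_one zero_neq_one lookup_single_eq)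
  ultimately show False
    using ndvd by (auto simp: factor_def)
qed

theorem lemma26:
  shows "\<exists>R :: nat ring. domain R \<and> \<not> antimatter_domain R \<and> \<not> quasi_Furstenberg R"
proof -
  have "countable (carrier puiseux_ring)"
    by (rule countable_subset[OF subset_UNIV countable_poly_mapping])
  then obtain S :: "nat ring" and h where "domain S" "h \<in> ring_iso puiseux_ring S"
    using countable_domain_iso_nat[OF domain_puiseux_ring] by blast
  then show ?thesis
    using ring_iso_antimatter_domain[OF _ domain_puiseux_ring]
      ring_iso_quasi_Furstenberg[OF _ domain_puiseux_ring]
      not_antimatter_puiseux_ring not_quasi_Furstenberg_puiseux_ring by blast
qed

end
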